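(* Let $b$ be a positive integer and let $f_b(x)$ be the inversion polynomial of $b$. Then $$f_b(-1)=\begin{cases}0 & \text{if } b \text{ is odd and not a perfect square, or } 4\mid b,\\ \varphi(b) & \text{if } b \text{ is an odd perfect square, or } b\equiv 2 \pmod 4,\end{cases}$$ where $\varphi$ is Euler's totient function. (In particular this determines exactly the $b$ for which $x+1$ divides $f_b(x)$.) Moreover, when $b$ is an odd perfect square or $b\equiv 2\pmod 4$, $\operatorname{inv}(a,b)$ is even for every integer $a$ relatively prime to $b$.
   Context: For a permutation $\sigma$ of $\{1,2,\dots,b\}$, its inversion number is $\operatorname{inv}(\sigma)=\#\{(i,j) : 1\le i<j\le b,\ \sigma(i)>\sigma(j)\}$. If $a$ is an integer relatively prime to $b$, let $\sigma_a:\{1,\dots,b\}\to\{1,\dots,b\}$ be the permutation sending $x$ to the unique element of $\{1,\dots,b\}$ congruent to $ax$ modulo $b$, and put $\operatorname{inv}(a,b)=\operatorname{inv}(\sigma_a)$. The inversion polynomial of a positive integer $b$ is $f_b(x)=\sum_{1\le a\le b,\ (a,b)=1} x^{\operatorname{inv}(a,b)}$. *)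

theory Defs
  imports
    "HOL-Number_Theory.Number_Theory"
    "HOL-Combinatorics.Permutations"
    "HOL-Computational_Algebra.Polynomial"
    "HOL-Computational_Algebra.Nth_Powers"
begin

definition inversion_number :: "nat \<Rightarrow> (nat \<Rightarrow> nat) \<Rightarrow> nat" where
  "inversion_number b \<sigma> = card {(i, j). 1 \<le> i \<and> i < j \<and> j \<le> b \<and> \<sigma> i > \<sigma> j}"

(* The representative set is {1..b} rather than {0..<b}: b itself represents the class of 0.
   Outside {1..b} the map is the identity, as required by "permutes". *)
definition mult_perm :: "nat \<Rightarrow> int \<Rightarrow> nat \<Rightarrow> nat" where
  "mult_perm b a x =
     (if x \<in> {1..b} then THE y. y \<in> {1..b} \<and> [int y = a * int x] (mod int b) else x)"

lemma ex1_representative: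
  assumes "b > 0"
  shows "\<exists>!y. y \<in> {1..b} \<and> [int y = c] (mod int b)"
proof (rule ex_ex1I)
  let ?y = "nat ((c - 1) mod int b + 1)"
  have nonneg: "0 \<le> (c - 1) mod int b" and less: "(c - 1) mod int b < int b"
    using assms by simp_all
  have "int ?y = (c - 1) mod int b + 1"
    using nonneg by simp
  moreover have "[(c - 1) mod int b + 1 = c - 1 + 1] (mod int b)"
    by (simp only: cong_def mod_add_left_eq)
  ultimately have "[int ?y = c] (mod int b)"
    by simp
  moreover have "?y \<in> {1..b}"
    using nonneg less by auto
  ultimately show "\<exists>y. y \<in> {1..b} \<and> [int y = c] (mod int b)"
    by blast
next
  fix y z
  assume y: "y \<in> {1..b} \<and> [int y = c] (mod int b)"
    and z: "z \<in> {1..b} \<and> [int z = c] (mod int b)"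
  then have "[int y = int z] (mod int b)"
    using cong_sym cong_trans by blast
  then have "int b dvd int y - int z"
    by (simp add: cong_iff_dvd_diff)
  moreover have "\<bar>int y - int z\<bar> < int b"
    using y z by auto
  ultimately show "y = z"
    using zdvd_not_zless[of "\<bar>int y - int z\<bar>" "int b"] by force
qed

lemma mult_perm_spec:
  assumes "x \<in> {1..b}"
  shows "mult_perm b a x \<in> {1..b}" "[int (mult_perm b a x) = a * int x] (mod int b)"
proof -
  have "b > 0" using assms by simp
  from theI'[OF ex1_representative[OF this, of "a * int x"]] assms
  show "mult_perm b a x \<in> {1..b}" "[int (mult_perm b a x) = a * int x] (mod int b)"
    unfolding mult_perm_def by simp_all
qed

lemma mult_perm_permutes:
  assumes "coprime a (int b)"
  shows "mult_perm b a permutes {1..b}"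
proof (rule bij_imp_permutes)
  have "inj_on (mult_perm b a) {1..b}"
  proof (rule inj_onI)
    fix x y
    assume x: "x \<in> {1..b}" and y: "y \<in> {1..b}" and eq: "mult_perm b a x = mult_perm b a y"
    have "[a * int x = a * int y] (mod int b)"
      using mult_perm_spec(2)[OF x, of a] mult_perm_spec(2)[OF y, of a] eq
      by (metis cong_sym cong_trans)
    then have "[int x = int y] (mod int b)"
      using assms by (simp add: cong_mult_lcancel)
    then show "x = y"
      using ex1_representative[of b "int y"] x y by auto
  qed
  moreover have "mult_perm b a ` {1..b} \<subseteq> {1..b}"
    using mult_perm_spec(1) by blast
  ultimately show "bij_betw (mult_perm b a) {1..b} {1..b}"
    by (simp add: bij_betw_def endo_inj_surj)
qed (auto simp: mult_perm_def)

definition mult_inv :: "int \<Rightarrow> nat \<Rightarrow> nat" where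
  "mult_inv a b = inversion_number b (mult_perm b a)"

definition inversion_poly :: "nat \<Rightarrow> int poly" where
  "inversion_poly b = (\<Sum>a | 1 \<le> a \<and> a \<le> b \<and> coprime a b. monom 1 (mult_inv (int a) b))"

end

theory Submission
  imports Defs
begin

text \<open>
  Write \<open>\<chi>\<close> for the map \<open>a \<mapsto> (- 1) ^ inv(a, b)\<close> on the residues prime to \<open>b\<close>. The parity of the
  inversion number of a permutation is its sign, so \<open>\<chi>\<close> is a homomorphism from the units
  modulo \<open>b\<close> to \<open>{1, - 1}\<close>, and \<open>f\<^sub>b(- 1)\<close> is the sum of its values. By orthogonality
  (\<open>sum_mult_sign_eq_0\<close>) this sum vanishes as soon as \<open>\<chi>\<close> takes the value \<open>- 1\<close>, and otherwise it
  is \<open>\<phi>(b)\<close>. Everything thus reduces to deciding for which \<open>b\<close> the homomorphism is trivial.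

  The main tool is \<open>mult_sign_modulus_mult\<close>, which computes the sign for a modulus \<open>m * n\<close> with
  \<open>n\<close> odd from the signs for \<open>m\<close> and \<open>n\<close>: multiplication by \<open>a\<close> permutes the residue classes
  modulo \<open>m\<close>, and on each class, identified with the residues modulo \<open>n\<close>, it is an affine map
  \<open>t \<mapsto> a * t + d\<close>. Translations modulo an odd number are squares of translations and hence even permutations,
  so the sign is \<open>\<chi>\<^sub>m(a) ^ n * \<chi>\<^sub>n(a) ^ m\<close>. For \<open>m = n\<close> odd this is \<open>1\<close>, which settles odd squares; for \<open>m = 2\<close> it is \<open>\<chi>\<^sub>2(a) = 1\<close>, which
  settles \<open>b \<equiv> 2\<close> modulo \<open>4\<close>.

  It remains to find negative values. If \<open>4\<close> divides \<open>b\<close>, then \<open>a = - 1\<close> works, since its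
  inversions are all the pairs from \<open>{1..b - 1}\<close>, an odd number. For a prime \<open>p\<close>, comparing the
  Vandermonde product of the differences \<open>j - i\<close> with its image under multiplication by \<open>a\<close> gives
  \<open>\<chi>\<^sub>p(a) \<equiv> a ^ (p * (p - 1) / 2)\<close> modulo \<open>p\<close>, so a primitive root modulo an odd prime has sign
  \<open>- 1\<close>. An odd nonsquare has the form \<open>p ^ k * n\<close> with \<open>p\<close> prime, \<open>k\<close> odd and \<open>p\<close> not dividing
  \<open>n\<close>; a residue that is a primitive root modulo \<open>p\<close> and \<open>1\<close> modulo \<open>n\<close> then has sign
  \<open>(- 1) ^ k = - 1\<close>.
\<close>

section \<open>Inversion parity is the sign of a permutation\<close>

definition index_pairs :: "nat \<Rightarrow> (nat \<times> nat) set" where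
  "index_pairs b = {(i, j). 1 \<le> i \<and> i < j \<and> j \<le> b}"

lemma finite_index_pairs [simp]: "finite (index_pairs b)"
  by (rule finite_subset[of _ "{1..b} \<times> {1..b}"]) (auto simp: index_pairs_def)

lemma index_pairs_Suc:
  "index_pairs (Suc b) = index_pairs b \<union> (\<lambda>i. (i, Suc b)) ` {1..b}"
  by (auto simp: index_pairs_def)

lemma card_index_pairs: "2 * card (index_pairs b) = b * (b - 1)"
proof (induction b)
  case 0
  have "index_pairs 0 = {}" by (auto simp: index_pairs_def)
  then show ?case by simp
next
  case (Suc b)
  have "card (index_pairs (Suc b)) = card (index_pairs b) + card ((\<lambda>i. (i, Suc b)) ` {1..b})"
    unfolding index_pairs_Suc by (rule card_Un_disjoint) (simp, simp, auto simp: index_pairs_def)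
  also have "card ((\<lambda>i. (i, Suc b)) ` {1..b}) = b"
    by (subst card_image) (auto simp: inj_on_def)
  finally show ?case using Suc by (cases b) auto
qed

text \<open>
  A permutation of the indices also permutes the unordered pairs of indices. Sorting the image
  pair turns this into a bijection of the increasing pairs, and a symmetric \<open>g\<close> does not notice
  the sorting.
\<close>
lemma prod_index_pairs_permute:
  fixes g :: "nat \<Rightarrow> nat \<Rightarrow> 'a :: comm_monoid_mult"
  assumes q: "q permutes {1..b}" and sym: "\<And>x y. g x y = g y x"
  shows "(\<Prod>(i, j)\<in>index_pairs b. g (q i) (q j)) = (\<Prod>(i, j)\<in>index_pairs b. g i j)"
proof -
  define h where "h = (\<lambda>(i, j). (min (q i) (q j), max (q i) (q j)))"
  have inj: "inj q"
    using q by (rule permutes_inj)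
  have "inj_on h (index_pairs b)"
  proof (rule inj_onI)
    fix x y assume *: "x \<in> index_pairs b" "y \<in> index_pairs b" "h x = h y"
    obtain i j k l where xy: "x = (i, j)" "y = (k, l)" by fastforce
    have "{q i, q j} = {q k, q l}"
      using *(3) by (auto simp: xy h_def min_def max_def split: if_splits)
    hence "q ` {i, j} = q ` {k, l}" by simp
    hence "{i, j} = {k, l}"
      using inj by (simp only: inj_image_eq_iff)
    thus "x = y"
      using *(1,2) by (auto simp: xy index_pairs_def doubleton_eq_iff)
  qed
  moreover have "h ` index_pairs b \<subseteq> index_pairs b"
  proof (rule image_subsetI)
    fix x assume x: "x \<in> index_pairs b"
    obtain i j where ij: "x = (i, j)" "(i, j) \<in> index_pairs b" using x by (cases x) auto
    have "q i \<in> {1..b}" "q j \<in> {1..b}"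
      using ij permutes_in_image[OF q] by (auto simp: index_pairs_def)
    moreover have "q i \<noteq> q j"
      using ij inj by (auto simp: index_pairs_def inj_def)
    ultimately show "h x \<in> index_pairs b"
      by (auto simp: ij(1) h_def index_pairs_def min_def max_def)
  qed
  ultimately have bij: "bij_betw h (index_pairs b) (index_pairs b)"
    by (simp add: bij_betw_def endo_inj_surj)
  have "(\<Prod>(i, j)\<in>index_pairs b. g (q i) (q j)) = (\<Prod>p\<in>index_pairs b. (\<lambda>(i, j). g i j) (h p))"
    by (intro prod.cong refl) (auto simp: h_def min_def max_def sym)
  also have "\<dots> = (\<Prod>(i, j)\<in>index_pairs b. g i j)"
    by (rule prod.reindex_bij_betw[OF bij])
  finally show ?thesis .
qed

lemma inversion_parity_eq_prod:
  assumes "p permutes {1..b}"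
  shows "(-1) ^ inversion_number b p = (\<Prod>(i, j)\<in>index_pairs b. sgn (int (p j) - int (p i)))"
proof -
  let ?I = "{x \<in> index_pairs b. p (fst x) > p (snd x)}"
  have "inj p" using assms by (rule permutes_inj)
  have "(\<Prod>(i, j)\<in>index_pairs b. sgn (int (p j) - int (p i))) =
      (\<Prod>x\<in>index_pairs b. if p (fst x) > p (snd x) then - 1 else 1)"
    using \<open>inj p\<close> by (intro prod.cong) (auto simp: index_pairs_def inj_eq sgn_if)
  also have "\<dots> = (-1) ^ card ?I"
    by (subst prod.If_cases) (auto simp: Int_def)
  also have "?I = {(i, j). 1 \<le> i \<and> i < j \<and> j \<le> b \<and> p i > p j}"
    by (auto simp: index_pairs_def)
  finally show ?thesis by (simp add: inversion_number_def)
qed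

text \<open>
  The quantity \<open>sgn (p y - p x) * sgn (y - x)\<close> is symmetric in \<open>x\<close> and \<open>y\<close>, so its product over
  all pairs does not change when the pairs are moved by \<open>q\<close>. The product for \<open>p \<circ> q\<close> therefore
  splits into the product for \<open>p\<close> and the product for \<open>q\<close>.
\<close>
lemma inversion_parity_compose:
  assumes p: "p permutes {1..b}" and q: "q permutes {1..b}"
  shows "(-1 :: int) ^ inversion_number b (p \<circ> q) =
    (-1) ^ inversion_number b p * (-1) ^ inversion_number b q"
proof -
  define g where "g x y = sgn (int (p y) - int (p x)) * sgn (int y - int x)" for x y
  have sym: "g x y = g y x" for x y
    by (auto simp: g_def sgn_if)
  have "(-1) ^ inversion_number b (p \<circ> q) =
      (\<Prod>(i, j)\<in>index_pairs b. sgn (int (p (q j)) - int (p (q i))))"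
    using inversion_parity_eq_prod[OF permutes_compose[OF q p]] by simp
  also have "\<dots> = (\<Prod>(i, j)\<in>index_pairs b. g (q i) (q j) * sgn (int (q j) - int (q i)))"
    using permutes_inj[OF q]
    by (intro prod.cong) (auto simp: g_def sgn_if index_pairs_def inj_eq)
  also have "\<dots> = (\<Prod>(i, j)\<in>index_pairs b. g (q i) (q j)) *
      (\<Prod>(i, j)\<in>index_pairs b. sgn (int (q j) - int (q i)))"
    by (simp add: case_prod_unfold prod.distrib)
  also have "(\<Prod>(i, j)\<in>index_pairs b. g (q i) (q j)) = (\<Prod>(i, j)\<in>index_pairs b. g i j)"
    using q sym by (rule prod_index_pairs_permute)
  also have "\<dots> = (\<Prod>(i, j)\<in>index_pairs b. sgn (int (p j) - int (p i)))"
    by (intro prod.cong) (auto simp: g_def index_pairs_def)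
  finally show ?thesis
    by (simp only: inversion_parity_eq_prod[OF p] inversion_parity_eq_prod[OF q])
qed

lemma inversion_number_adjacent_transpose:
  assumes "1 \<le> i" "Suc i \<le> b"
  shows "inversion_number b (transpose i (Suc i)) = 1"
proof -
  have "{(k, l). 1 \<le> k \<and> k < l \<and> l \<le> b \<and> transpose i (Suc i) k > transpose i (Suc i) l}
      = {(i, Suc i)}"
    using assms by (auto simp: transpose_def split: if_splits)
  thus ?thesis by (simp add: inversion_number_def)
qed

text \<open>
  Induction on \<open>j\<close>: the transposition of \<open>i\<close> and \<open>k + 1\<close> is conjugate to that of \<open>i\<close> and \<open>k\<close> by an
  adjacent transposition, and the conjugating factor enters the parity twice.
\<close>
lemma inversion_parity_transpose:
  assumes "1 \<le> i" "i < j" "j \<le> b"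
  shows "(-1 :: int) ^ inversion_number b (transpose i j) = - 1"
  using assms(2,3)
proof (induction j rule: less_induct)
  case (less j)
  obtain k where k: "j = Suc k" using less.prems by (cases j) auto
  show ?case
  proof (cases "k = i")
    case True
    thus ?thesis using inversion_number_adjacent_transpose[of i b] k less.prems assms(1) by simp
  next
    case False
    hence "i < k" using k less.prems by simp
    have perm: "transpose i k permutes {1..b}" "transpose k j permutes {1..b}"
      using \<open>i < k\<close> less.prems assms(1) k by (auto intro!: permutes_swap_id)
    have eq: "transpose i j = transpose k j \<circ> (transpose i k \<circ> transpose k j)"
      using \<open>i < k\<close> k by (auto simp: fun_eq_iff transpose_def)
    have "(-1 :: int) ^ inversion_number b (transpose i j) =
        ((-1) ^ inversion_number b (transpose k j))\<^sup>2 * (-1) ^ inversion_number b (transpose i k)"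
      unfolding eq using perm
      by (simp add: inversion_parity_compose permutes_compose power2_eq_square algebra_simps)
    also have "\<dots> = (-1) ^ inversion_number b (transpose i k)"
      by (simp add: power2_eq_square flip: power_mult_distrib)
    also have "\<dots> = - 1"
      using less.IH[of k] \<open>i < k\<close> k less.prems by simp
    finally show ?thesis .
  qed
qed

text \<open>
  Both sides are multiplicative and take the value \<open>- 1\<close> on transpositions, which generate all
  permutations.
\<close>
lemma inversion_parity_eq_sign:
  assumes "p permutes {1..b}"
  shows "(-1) ^ inversion_number b p = sign p"
  using assms finite_atLeastAtMost
proof (induction rule: permutes_induct)
  case id
  have "{(i, j). 1 \<le> i \<and> i < j \<and> j \<le> b \<and> id i > id j} = ({} :: (nat \<times> nat) set)"
    by auto
  then have "inversion_number b id = 0"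
    by (simp only: inversion_number_def card.empty)
  then show ?case by (simp add: id_def)
next
  case (swap i j p)
  have "(-1 :: int) ^ inversion_number b (transpose i j) = - 1"
    using inversion_parity_transpose[of i j b] inversion_parity_transpose[of j i b] swap
    by (cases "i < j") (auto simp: transpose_commute)
  moreover have "transpose i j permutes {1..b}"
    using swap by (intro permutes_swap_id)
  moreover have "sign (transpose i j \<circ> p) = - sign p"
    using swap by (subst sign_compose)
      (auto simp: sign_swap_id permutation_swap_id intro: permutes_imp_permutation)
  ultimately show ?case
    using swap by (subst inversion_parity_compose) auto
qed

section \<open>Signs of fibrewise permutations\<close>

text \<open>
  The sign does not depend on the names of the points. This is what allows the residues modulo
  \<open>m * n\<close> to be replaced by pairs, and a fibre of a product by its other factor.
\<close>
lemma sign_on_conjugate: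
  assumes f: "bij_betw f A B" and g: "bij_betw g A A" and fin: "finite A"
    and h: "\<And>x. x \<in> A \<Longrightarrow> h (f x) = f (g x)"
  shows "sign_on B h = sign_on A g"
proof -
  have inj: "inj_on f A" and im: "B = f ` A"
    using f by (auto simp: bij_betw_def)
  have perm: "restrict_id g A permutes A"
    using g by (rule permutes_restrict_id)
  have "restrict_id h B = map_permutation A f (restrict_id g A)"
  proof
    fix y
    show "restrict_id h B y = map_permutation A f (restrict_id g A) y"
    proof (cases "y \<in> B")
      case True
      then obtain x where "x \<in> A" "y = f x" using im by auto
      thus ?thesis using True by (simp add: map_permutation_apply[OF inj] h)
    next
      case False
      thus ?thesis by (simp add: map_permutation_def im)
    qed
  qed
  thus ?thesis
    using sign_map_permutation[OF inj perm fin] by (simp add: sign_on_def)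
qed

lemma sign_on_disjoint_Un:
  assumes "finite A" "finite B" "A \<inter> B = {}" "bij_betw p A A" "bij_betw p B B"
  shows "sign_on (A \<union> B) p = sign_on A p * sign_on B p"
proof -
  have *: "restrict_id p A permutes A" "restrict_id p B permutes B"
    using assms by (auto intro: permutes_restrict_id)
  have "p x \<in> B" if "x \<in> B" for x
    using assms(5) that by (auto simp: bij_betw_def)
  hence "restrict_id p (A \<union> B) = restrict_id p A \<circ> restrict_id p B"
    using assms(3) by (auto simp: fun_eq_iff restrict_id_def)
  thus ?thesis
    using * assms(1,2) unfolding sign_on_def
    by (simp add: sign_compose permutes_imp_permutation)
qed

lemma sign_on_UNION:
  assumes "finite I" "\<And>i. i \<in> I \<Longrightarrow> finite (X i)" "disjoint_family_on X I"
    and "\<And>i. i \<in> I \<Longrightarrow> bij_betw p (X i) (X i)"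
  shows "sign_on (\<Union>i\<in>I. X i) p = (\<Prod>i\<in>I. sign_on (X i) p)"
  using assms
proof (induction I rule: finite_induct)
  case empty
  have "restrict_id p {} = id" by (auto simp: restrict_id_def)
  then show ?case by (simp add: sign_on_def)
next
  case (insert i I)
  have dis: "disjoint_family_on X I" "X i \<inter> (\<Union>j\<in>I. X j) = {}"
    using insert.prems(2) insert.hyps by (auto simp: disjoint_family_on_def)
  have "bij_betw p (\<Union>j\<in>I. X j) (\<Union>j\<in>I. X j)"
    using insert dis by (intro bij_betw_UNION_disjoint) auto
  then show ?case
    using insert dis by (simp add: sign_on_disjoint_Un)
qed


text \<open>
  The map is the composition of a motion inside the fibres \<open>{u} \<times> B\<close> with a motion that acts by \<open>s\<close>
  on each slice \<open>A \<times> {t}\<close>. The latter consists of \<open>card B\<close> disjoint copies of \<open>s\<close>.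
\<close>
lemma sign_on_skew_product:
  assumes fin: "finite A" "finite B"
    and s: "bij_betw s A A" and r: "\<And>u. u \<in> A \<Longrightarrow> bij_betw (r u) B B"
  shows "sign_on (A \<times> B) (\<lambda>(u, t). (s u, r u t)) =
    sign_on A s ^ card B * (\<Prod>u\<in>A. sign_on B (r u))"
proof -
  define base where "base = (\<lambda>(u, t :: 'b). (s u, t))"
  define fib where "fib = (\<lambda>(u, t). (u, r u t))"
  have base_bij: "bij_betw base (A \<times> {t}) (A \<times> {t})" for t
    using s by (auto simp: bij_betw_def inj_on_def base_def image_iff) blast
  have fib_bij: "bij_betw fib ({u} \<times> B) ({u} \<times> B)" if "u \<in> A" for u
    using r[OF that] by (auto simp: bij_betw_def inj_on_def fib_def image_iff) blast
  have rows: "A \<times> B = (\<Union>t\<in>B. A \<times> {t})" and columns: "A \<times> B = (\<Union>u\<in>A. {u} \<times> B)"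
    by auto
  have dis: "disjoint_family_on (\<lambda>t. A \<times> {t}) B" "disjoint_family_on (\<lambda>u. {u} \<times> B) A"
    by (auto simp: disjoint_family_on_def)
  have "sign_on (A \<times> B) base = (\<Prod>t\<in>B. sign_on (A \<times> {t}) base)"
    unfolding rows using fin dis base_bij by (intro sign_on_UNION) auto
  also have "\<dots> = (\<Prod>t\<in>B. sign_on A s)"
    using fin s by (intro prod.cong refl sign_on_conjugate[where f = "\<lambda>u. (u, _)"])
      (auto simp: bij_betw_def inj_on_def base_def)
  finally have base_sign: "sign_on (A \<times> B) base = sign_on A s ^ card B"
    by simp
  have "sign_on (A \<times> B) fib = (\<Prod>u\<in>A. sign_on ({u} \<times> B) fib)"
    unfolding columns using fin dis fib_bij by (intro sign_on_UNION) auto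
  also have "\<dots> = (\<Prod>u\<in>A. sign_on B (r u))"
    using fin r by (intro prod.cong refl sign_on_conjugate[where f = "Pair _"])
      (auto simp: bij_betw_def inj_on_def fib_def)
  finally have fib_sign: "sign_on (A \<times> B) fib = (\<Prod>u\<in>A. sign_on B (r u))" .
  have bij: "bij_betw base (A \<times> B) (A \<times> B)" "bij_betw fib (A \<times> B) (A \<times> B)"
  proof -
    show "bij_betw base (A \<times> B) (A \<times> B)"
      unfolding rows by (rule bij_betw_UNION_disjoint) (use dis base_bij in auto)
    show "bij_betw fib (A \<times> B) (A \<times> B)"
      unfolding columns by (rule bij_betw_UNION_disjoint) (use dis fib_bij in auto)
  qed
  have comp: "(\<lambda>(u, t). (s u, r u t)) = base \<circ> fib"
    by (auto simp: base_def fib_def)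
  show ?thesis
    unfolding comp base_sign[symmetric] fib_sign[symmetric]
    using bij fin by (intro sign_on_compose) auto
qed

section \<open>Affine permutations of the residues\<close>

text \<open>
  The shift by one makes \<open>n\<close>, rather than \<open>0\<close>, represent the class of \<open>0\<close>.
\<close>
definition residue_rep :: "nat \<Rightarrow> int \<Rightarrow> nat" where
  "residue_rep n c = nat ((c - 1) mod int n + 1)"

lemma residue_rep_in [simp]: "n > 0 \<Longrightarrow> residue_rep n c \<in> {1..n}"
proof -
  assume "n > 0"
  hence "0 \<le> (c - 1) mod int n" "(c - 1) mod int n < int n" by simp_all
  thus ?thesis by (auto simp: residue_rep_def)
qed

lemma residue_rep_cong: "n > 0 \<Longrightarrow> [int (residue_rep n c) = c] (mod int n)"
proof -
  assume "n > 0"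
  hence "int (residue_rep n c) = (c - 1) mod int n + 1" by (simp add: residue_rep_def)
  thus ?thesis by (metis cong_def diff_add_cancel mod_add_left_eq)
qed

lemma residue_rep_unique:
  assumes "y \<in> {1..n}" "[int y = c] (mod int n)"
  shows "residue_rep n c = y"
proof -
  have "n > 0" using assms by simp
  thus ?thesis
    using ex1_representative[of n c] residue_rep_in[of n c] residue_rep_cong[of n c] assms
    by blast
qed

lemma residue_rep_eqI:
  assumes "n > 0" "[c = d] (mod int n)"
  shows "residue_rep n c = residue_rep n d"
  using residue_rep_cong[OF assms(1), of d] residue_rep_in[OF assms(1), of d] cong_sym[OF assms(2)]
  by (intro residue_rep_unique) (blast intro: cong_trans)+

lemma mult_perm_eq_residue_rep:
  assumes "x \<in> {1..n}"
  shows "mult_perm n a x = residue_rep n (a * int x)"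
  using mult_perm_spec[OF assms] by (intro residue_rep_unique[symmetric])

definition affine_map :: "nat \<Rightarrow> int \<Rightarrow> int \<Rightarrow> nat \<Rightarrow> nat" where
  "affine_map n a d x = residue_rep n (a * int x + d)"

lemma affine_map_compose:
  assumes "n > 0"
  shows "affine_map n a d (affine_map n a' d' x) = affine_map n (a * a') (a * d' + d) x"
proof -
  have "[a * int (residue_rep n (a' * int x + d')) + d = a * (a' * int x + d') + d] (mod int n)"
    using residue_rep_cong[OF assms] by (intro cong_add cong_mult) auto
  thus ?thesis
    unfolding affine_map_def using assms by (intro residue_rep_eqI) (auto simp: algebra_simps)
qed

lemma affine_map_cong:
  assumes "n > 0" "[a = a'] (mod int n)" "[d = d'] (mod int n)"
  shows "affine_map n a d x = affine_map n a' d' x"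
  unfolding affine_map_def using assms by (intro residue_rep_eqI cong_add cong_mult) auto

lemma affine_map_one_zero [simp]: "x \<in> {1..n} \<Longrightarrow> affine_map n 1 0 x = x"
  unfolding affine_map_def by (rule residue_rep_unique) auto

text \<open>
  The affine map with slope \<open>a'\<close> inverse to \<open>a\<close> modulo \<open>n\<close> and intercept \<open>- a' * d\<close> undoes the map.
\<close>
lemma affine_map_bij:
  assumes "n > 0" "coprime a (int n)"
  shows "bij_betw (affine_map n a d) {1..n} {1..n}"
proof -
  obtain a' where a': "[a * a' = 1] (mod int n)"
    using cong_solve_coprime_int[OF assms(2)] by auto
  have "affine_map n a' (- a' * d) (affine_map n a d x) = x" if "x \<in> {1..n}" for x
  proof -
    have "affine_map n a' (- a' * d) (affine_map n a d x) = affine_map n (a' * a) 0 x"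
      using assms(1) by (simp add: affine_map_compose)
    also have "\<dots> = affine_map n 1 0 x"
      using assms(1) a' by (intro affine_map_cong) (auto simp: mult.commute)
    finally show ?thesis using that by simp
  qed
  hence "inj_on (affine_map n a d) {1..n}"
    by (rule inj_on_inverseI)
  moreover have "affine_map n a d ` {1..n} \<subseteq> {1..n}"
    using assms(1) residue_rep_in[of n] by (auto simp: affine_map_def)
  ultimately show ?thesis
    by (simp add: bij_betw_def endo_inj_surj)
qed

lemma sign_on_square:
  assumes "finite A" "bij_betw f A A"
  shows "sign_on A (f \<circ> f) = 1"
  using assms by (subst sign_on_compose) (auto simp: sign_on_def)

text \<open>
  Two is invertible modulo an odd number, so the translation by \<open>d\<close> is the square of the translation
  by half of \<open>d\<close>, and the square of a permutation is even.
\<close>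
lemma sign_on_translation:
  assumes "odd n"
  shows "sign_on {1..n} (affine_map n 1 d) = 1"
proof -
  have n: "n > 0" using assms by (cases n) auto
  \<comment> \<open>The inverse of \<open>2\<close> modulo \<open>n\<close> is \<open>(n + 1) / 2\<close>.\<close>
  define h where "h = d * ((int n + 1) div 2)"
  have "2 * h = d * (int n + 1)"
    using assms unfolding h_def by (auto elim!: oddE)
  hence "h + h - d = d * int n"
    by (simp add: algebra_simps)
  hence "[h + h = d] (mod int n)"
    by (simp add: cong_iff_dvd_diff)
  hence "affine_map n 1 (h + h) = affine_map n 1 d"
    using n by (intro ext affine_map_cong) auto
  hence "affine_map n 1 d = affine_map n 1 h \<circ> affine_map n 1 h"
    using n by (auto simp: fun_eq_iff affine_map_compose)
  hence "sign_on {1..n} (affine_map n 1 d) = sign_on {1..n} (affine_map n 1 h \<circ> affine_map n 1 h)"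
    by (rule arg_cong)
  also have "\<dots> = 1"
    using n by (intro sign_on_square affine_map_bij) auto
  finally show ?thesis .
qed

text \<open>
  This is the sign of \<^const>\<open>mult_perm\<close>, expressed through the affine map with intercept \<open>0\<close> so
  that the composition and congruence rules for affine maps apply to it directly.
\<close>
definition mult_sign :: "nat \<Rightarrow> int \<Rightarrow> int" where
  "mult_sign b a = sign_on {1..b} (affine_map b a 0)"

lemma sign_on_affine_map:
  assumes "odd n" "coprime a (int n)"
  shows "sign_on {1..n} (affine_map n a d) = mult_sign n a"
proof -
  have n: "n > 0" using assms(1) by (cases n) auto
  have "sign_on {1..n} (affine_map n a d) = sign_on {1..n} (affine_map n 1 d \<circ> affine_map n a 0)"
    using n by (intro sign_on_cong) (auto simp: affine_map_compose)
  also have "\<dots> = sign_on {1..n} (affine_map n 1 d) * mult_sign n a"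
    unfolding mult_sign_def using n assms by (intro sign_on_compose affine_map_bij) auto
  finally show ?thesis unfolding sign_on_translation[OF assms(1)] by simp
qed

lemma mult_sign_eq_inversion_parity:
  assumes "b > 0" "coprime a (int b)"
  shows "(-1) ^ mult_inv a b = mult_sign b a"
proof -
  have "(-1) ^ mult_inv a b = sign (mult_perm b a)"
    unfolding mult_inv_def by (intro inversion_parity_eq_sign mult_perm_permutes assms)
  also have "\<dots> = sign_on {1..b} (mult_perm b a)"
    by (rule sign_on_permutes[symmetric, OF mult_perm_permutes[OF assms(2)]]) simp
  also have "\<dots> = mult_sign b a"
    unfolding mult_sign_def
    by (intro sign_on_cong) (auto simp: mult_perm_eq_residue_rep affine_map_def)
  finally show ?thesis .
qed

lemma mult_sign_cases: "mult_sign b a = 1 \<or> mult_sign b a = - 1"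
  by (simp add: mult_sign_def sign_on_def sign_def)

lemma mult_sign_mult:
  assumes "b > 0" "coprime a (int b)" "coprime c (int b)"
  shows "mult_sign b (a * c) = mult_sign b a * mult_sign b c"
proof -
  have "mult_sign b (a * c) = sign_on {1..b} (affine_map b a 0 \<circ> affine_map b c 0)"
    unfolding mult_sign_def using assms by (intro sign_on_cong) (auto simp: affine_map_compose)
  also have "\<dots> = mult_sign b a * mult_sign b c"
    unfolding mult_sign_def using assms by (intro sign_on_compose affine_map_bij) auto
  finally show ?thesis .
qed

lemma mult_sign_cong:
  assumes "b > 0" "[a = c] (mod int b)"
  shows "mult_sign b a = mult_sign b c"
  unfolding mult_sign_def using assms by (intro sign_on_cong affine_map_cong) auto

lemma mult_sign_one: "mult_sign b 1 = 1"
proof -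
  have "mult_sign b 1 = sign_on {1..b} id"
    unfolding mult_sign_def by (intro sign_on_cong) auto
  thus ?thesis by simp
qed

section \<open>The sign for a product of moduli\<close>

text \<open>
  Every element of \<open>{1..m * n}\<close> is uniquely \<open>u + m * (t - 1)\<close> with \<open>u\<close> in \<open>{1..m}\<close> and \<open>t\<close> in
  \<open>{1..n}\<close>. If \<open>a * u = s u + m * c u\<close> with \<open>s u\<close> in \<open>{1..m}\<close>, then multiplication by \<open>a\<close> sends this
  element to \<open>s u + m * (c u + a * (t - 1))\<close>. In these coordinates it is a skew product over \<open>s\<close>
  whose fibre maps are affine with slope \<open>a\<close>, and oddness of \<open>n\<close> removes the intercepts.
\<close>
lemma mult_sign_modulus_mult:
  assumes m: "m > 0" and n: "odd n" and a: "coprime a (int (m * n))"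
  shows "mult_sign (m * n) a = mult_sign m a ^ n * mult_sign n a ^ m"
proof -
  have n0: "n > 0" using n by (cases n) auto
  have cop: "coprime a (int m)" "coprime a (int n)"
    using a by auto
  define e where "e = (\<lambda>(u, t). u + m * (t - 1))"
  define s where "s = affine_map m a 0"
  define c where "c u = (a * int u - int (s u)) div int m" for u
  \<comment> \<open>The new second coordinate \<open>t'\<close> satisfies \<open>t' - 1 = c u + a * (t - 1)\<close> modulo \<open>n\<close>.\<close>
  define r where "r u = affine_map n a (c u + 1 - a)" for u
  have sB: "s u \<in> {1..m}" for u
    using m residue_rep_in[of m] by (simp add: s_def affine_map_def)
  have rB: "r u t \<in> {1..n}" for u t
    using n0 residue_rep_in[of n] by (simp add: r_def affine_map_def)
  have c: "a * int u = int (s u) + int m * c u" for u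
  proof -
    have "[int (s u) = a * int u] (mod int m)"
      using residue_rep_cong[OF m] by (simp add: s_def affine_map_def)
    hence "int m dvd a * int u - int (s u)"
      using cong_iff_dvd_diff cong_sym by blast
    thus ?thesis by (simp add: c_def)
  qed
  have inj: "inj_on e ({1..m} \<times> {1..n})"
  proof (rule inj_onI)
    fix x y assume *: "x \<in> {1..m} \<times> {1..n}" "y \<in> {1..m} \<times> {1..n}" "e x = e y"
    obtain u t v w where xy: "x = (u, t)" "y = (v, w)" by fastforce
    have div: "(e (u, t) - 1) div m = t - 1 \<and> (e (u, t) - 1) mod m = u - 1"
      if "u \<in> {1..m}" for u t
    proof -
      have "e (u, t) - 1 = (u - 1) + m * (t - 1)" using that by (auto simp: e_def)
      moreover have "u - 1 < m" using that by auto
      ultimately show ?thesis by simp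
    qed
    from div[of u t] div[of v w] show "x = y"
      using * by (auto simp: xy)
  qed
  have le: "e (u, t) \<in> {1..m * n}" if "u \<in> {1..m}" "t \<in> {1..n}" for u t
  proof -
    have "u + m * (t - 1) \<le> m + m * (t - 1)" using that by simp
    also have "\<dots> = m * t" using that by (cases t) auto
    also have "\<dots> \<le> m * n" using that by simp
    finally show ?thesis using that by (simp add: e_def)
  qed
  have "e ` ({1..m} \<times> {1..n}) = {1..m * n}"
    by (rule card_subset_eq) (use le inj in \<open>auto simp: card_image\<close>)
  with inj have e_bij: "bij_betw e ({1..m} \<times> {1..n}) {1..m * n}"
    by (simp add: bij_betw_def)
  have s_bij: "bij_betw s {1..m} {1..m}"
    unfolding s_def using m cop by (intro affine_map_bij)
  have r_bij: "bij_betw (r u) {1..n} {1..n}" for u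
    unfolding r_def using n0 cop by (intro affine_map_bij)
  define p where "p = (\<lambda>(u, t). (s u, r u t))"
  have p_bij: "bij_betw p ({1..m} \<times> {1..n}) ({1..m} \<times> {1..n})"
  proof -
    have "inj_on p ({1..m} \<times> {1..n})"
    proof (rule inj_onI)
      fix x y assume *: "x \<in> {1..m} \<times> {1..n}" "y \<in> {1..m} \<times> {1..n}" "p x = p y"
      obtain u t v w where xy: "x = (u, t)" "y = (v, w)" by fastforce
      have "u = v"
        using * bij_betw_imp_inj_on[OF s_bij] by (auto simp: xy p_def dest: inj_onD)
      moreover from this have "t = w"
        using * bij_betw_imp_inj_on[OF r_bij[of u]] by (auto simp: xy p_def dest: inj_onD)
      ultimately show "x = y" by (simp add: xy)
    qed
    moreover have "p ` ({1..m} \<times> {1..n}) \<subseteq> {1..m} \<times> {1..n}"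
      using sB rB by (auto simp: p_def)
    ultimately show ?thesis
      by (simp add: bij_betw_def endo_inj_surj)
  qed
  have equivariant: "affine_map (m * n) a 0 (e x) = e (p x)" if x: "x \<in> {1..m} \<times> {1..n}" for x
  proof -
    obtain u t where ut: "x = (u, t)" "u \<in> {1..m}" "t \<in> {1..n}" using x by auto
    have "[int (r u t) = a * int t + (c u + 1 - a)] (mod int n)"
      unfolding r_def affine_map_def using residue_rep_cong[OF n0] by simp
    hence "[int (r u t) - 1 = c u + a * (int t - 1)] (mod int n)"
      by (simp add: cong_iff_dvd_diff algebra_simps)
    hence "[int m * (int (r u t) - 1) = int m * (c u + a * (int t - 1))] (mod (int m * int n))"
      by (simp add: cong_iff_dvd_diff flip: right_diff_distrib)
    hence "[int (s u) + int m * (int (r u t) - 1) =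
        int (s u) + int m * (c u + a * (int t - 1))] (mod (int m * int n))"
      by (intro cong_add) auto
    also have "int (s u) + int m * (c u + a * (int t - 1)) = a * (int u + int m * (int t - 1))"
      using c[of u] by (simp add: algebra_simps)
    also have "int u + int m * (int t - 1) = int (e x)"
      using ut by (simp add: e_def of_nat_diff)
    also have "int (s u) + int m * (int (r u t) - 1) = int (e (p x))"
      using rB[of u t] by (simp add: ut p_def e_def of_nat_diff)
    finally have "[int (e (p x)) = a * int (e x)] (mod int (m * n))" by simp
    moreover have "e (p x) \<in> {1..m * n}"
      using le sB rB by (simp add: ut p_def)
    ultimately show ?thesis
      unfolding affine_map_def by (intro residue_rep_unique) auto
  qed
  have "mult_sign (m * n) a = sign_on ({1..m} \<times> {1..n}) p"
    unfolding mult_sign_def using e_bij p_bij equivariant by (intro sign_on_conjugate) auto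
  also have "\<dots> = sign_on {1..m} s ^ card {1..n} * (\<Prod>u\<in>{1..m}. sign_on {1..n} (r u))"
    unfolding p_def using s_bij r_bij by (intro sign_on_skew_product) auto
  also have "(\<Prod>u\<in>{1..m}. sign_on {1..n} (r u)) = (\<Prod>u\<in>{1..m}. mult_sign n a)"
    unfolding r_def using n cop by (intro prod.cong refl sign_on_affine_map)
  also have "sign_on {1..m} s ^ card {1..n} * \<dots> = mult_sign m a ^ n * mult_sign n a ^ m"
    by (simp add: s_def mult_sign_def[of m])
  finally show ?thesis .
qed


lemma mult_sign_power_odd: "odd k \<Longrightarrow> mult_sign b a ^ k = mult_sign b a"
  using mult_sign_cases[of b a] by auto

lemma mult_sign_power_even: "even k \<Longrightarrow> mult_sign b a ^ k = 1"
  using mult_sign_cases[of b a] by auto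

lemma mult_sign_odd_modulus_mult:
  assumes "odd m" "odd n" "coprime a (int (m * n))"
  shows "mult_sign (m * n) a = mult_sign m a * mult_sign n a"
  using mult_sign_modulus_mult[of m n a] assms
  by (simp add: mult_sign_power_odd odd_pos)

lemma mult_sign_odd_square:
  assumes "odd b" "is_square b" "coprime a (int b)"
  shows "mult_sign b a = 1"
proof -
  obtain m where m: "b = m * m"
    using assms(2) by (auto elim!: is_nth_powerE simp: power2_eq_square)
  thus ?thesis
    using assms mult_sign_odd_modulus_mult[of m m a] mult_sign_power_even[of 2 m a]
    by (simp add: power2_eq_square)
qed

lemma mult_sign_twice_odd:
  assumes "[b = 2] (mod 4)" "coprime a (int b)"
  shows "mult_sign b a = 1"
proof -
  have "b mod 4 = 2" using assms(1) by (simp add: cong_def)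
  hence "b = 2 * (b div 2)" "odd (b div 2)" by presburger+
  then obtain n where n: "b = 2 * n" "odd n" by blast
  have "coprime a 2" using assms(2) n by simp
  hence "odd a" by (simp add: coprime_right_2_iff_odd)
  hence "[a = 1] (mod int 2)" by (auto simp: cong_def elim!: oddE)
  hence "mult_sign 2 a = 1"
    using mult_sign_cong[of 2 a 1] by (simp add: mult_sign_one)
  thus ?thesis
    using mult_sign_modulus_mult[of 2 n a] assms(2) n by (simp add: mult_sign_power_even)
qed

section \<open>Moduli with a negative sign\<close>

text \<open>
  Let \<open>V\<close> be the product of all differences \<open>j - i\<close> with \<open>i < j\<close> in \<open>{1..p}\<close>. Replacing each index
  by its image under multiplication by \<open>a\<close> changes \<open>V\<close> exactly by the sign; modulo \<open>p\<close> it
  multiplies every factor by \<open>a\<close>. All factors lie strictly between \<open>0\<close> and \<open>p\<close>, so \<open>V\<close> can be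
  cancelled.
\<close>
lemma mult_sign_prime:
  assumes p: "prime p" and a: "coprime a (int p)"
  shows "[mult_sign p a = a ^ card (index_pairs p)] (mod int p)"
proof -
  let ?P = "index_pairs p" and ?s = "mult_perm p a"
  define V where "V = (\<Prod>(i, j)\<in>?P. int j - int i)"
  have p0: "p > 0" using p by (simp add: prime_gt_0_nat)
  have perm: "?s permutes {1..p}" using a by (rule mult_perm_permutes)
  have "(\<Prod>(i, j)\<in>?P. \<bar>int (?s j) - int (?s i)\<bar>) = (\<Prod>(i, j)\<in>?P. \<bar>int j - int i\<bar>)"
    using prod_index_pairs_permute[OF perm, of "\<lambda>i j. \<bar>int j - int i\<bar>"]
    by (simp add: abs_minus_commute)
  also have "\<dots> = V"
    unfolding V_def by (intro prod.cong) (auto simp: index_pairs_def)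
  finally have abs: "(\<Prod>(i, j)\<in>?P. \<bar>int (?s j) - int (?s i)\<bar>) = V" .
  have "mult_sign p a * V = (\<Prod>(i, j)\<in>?P. int (?s j) - int (?s i))"
    unfolding mult_sign_eq_inversion_parity[OF p0 a, symmetric] mult_inv_def
      inversion_parity_eq_prod[OF perm] abs[symmetric]
    by (simp add: case_prod_unfold sgn_mult_abs flip: prod.distrib)
  also have "[\<dots> = (\<Prod>(i, j)\<in>?P. a * (int j - int i))] (mod int p)"
    unfolding case_prod_unfold right_diff_distrib
    by (intro cong_prod cong_diff mult_perm_spec(2)) (auto simp: index_pairs_def)
  also have "(\<Prod>(i, j)\<in>?P. a * (int j - int i)) = a ^ card ?P * V"
    by (simp add: V_def case_prod_unfold prod.distrib)
  finally have "[mult_sign p a * V = a ^ card ?P * V] (mod int p)" .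
  moreover have "coprime V (int p)"
    unfolding V_def
  proof (rule prod_coprime_left, safe)
    fix i j assume "(i, j) \<in> ?P"
    hence "0 < int j - int i" "int j - int i < int p" by (auto simp: index_pairs_def)
    hence "\<not> int p dvd int j - int i" using zdvd_not_zless by blast
    thus "coprime (int j - int i) (int p)"
      using p by (simp add: coprime_commute prime_imp_coprime)
  qed
  ultimately show ?thesis
    by (simp add: cong_mult_rcancel)
qed

text \<open>
  A primitive root has order \<open>p - 1\<close>. Sign \<open>1\<close> would make \<open>p - 1\<close> divide \<open>p * (p - 1) / 2\<close>, which
  is impossible for odd \<open>p\<close>.
\<close>
lemma exists_negative_mult_sign_prime:
  assumes p: "prime p" "odd p"
  shows "\<exists>g. coprime g (int p) \<and> mult_sign p g = - 1"
proof -
  obtain g where g: "residue_primroot p g"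
    using prime_primitive_root_exists[OF prime_gt_1_nat] p(1) by blast
  have cop: "coprime (int g) (int p)" and ord: "ord p g = p - 1"
    using g p(1) by (auto simp: residue_primroot_def totient_prime coprime_commute)
  have p2: "p > 2" using p prime_gt_1_nat[of p] by (cases "p = 2") auto
  have "mult_sign p (int g) \<noteq> 1"
  proof
    assume "mult_sign p (int g) = 1"
    hence "[int g ^ card (index_pairs p) = 1] (mod int p)"
      using mult_sign_prime[OF p(1) cop] by (simp add: cong_sym)
    hence "[g ^ card (index_pairs p) = 1] (mod p)"
      by (simp flip: cong_int_iff)
    then obtain k where "card (index_pairs p) = (p - 1) * k"
      unfolding ord_divides ord by (elim dvdE)
    hence "(p - 1) * (2 * k) = (p - 1) * p"
      using card_index_pairs[of p] by (simp add: mult_ac)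
    hence "p = 2 * k" using p2 by simp
    thus False using p(2) by simp
  qed
  thus ?thesis using cop mult_sign_cases by blast
qed

lemma mult_sign_prime_power:
  assumes "odd p" "coprime a (int p)"
  shows "mult_sign (p ^ k) a = mult_sign p a ^ k"
proof (induction k)
  case 0
  have "mult_sign 1 a = mult_sign 1 1"
    by (rule mult_sign_cong) (auto simp: cong_def)
  then show ?case by (simp add: mult_sign_one)
next
  case (Suc k)
  then show ?case
    using mult_sign_odd_modulus_mult[of p "p ^ k" a] assms by simp
qed

lemma exists_negative_mult_sign_odd_nonsquare:
  assumes b: "odd b" "\<not> is_square b"
  shows "\<exists>a. coprime a (int b) \<and> mult_sign b a = - 1"
proof -
  have b0: "b \<noteq> 0" using b(1) by (cases b) auto
  obtain p where p: "prime p" "odd (multiplicity p b)"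
    using b(2) is_nth_power_conv_multiplicity_nat[of 2 b] by auto
  define k where "k = multiplicity p b"
  obtain n where n: "b = p ^ k * n" "\<not> p dvd n"
    using multiplicity_decompose'[of b p] b0 p(1) unfolding k_def
    by (metis not_prime_unit)
  have k: "odd k" "k > 0" using p(2) by (auto simp: k_def odd_pos)
  have odd: "odd p" "odd n" using b(1) n(1) k by auto
  have pn: "coprime (int p) (int n)"
    using p(1) n(2) by (simp add: prime_imp_coprime)
  obtain g where g: "coprime g (int p)" "mult_sign p g = - 1"
    using exists_negative_mult_sign_prime[OF p(1) odd(1)] by blast
  obtain a where a: "[a = g] (mod int p)" "[a = 1] (mod int n)"
    using binary_chinese_remainder_int[OF pn] by blast
  have cop: "coprime a (int p)" "coprime a (int n)"
    using a g(1) by (metis cong_imp_coprime cong_sym coprime_commute, metis cong_imp_coprime cong_sym coprime_1_left)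
  have "mult_sign b a = mult_sign p a ^ k * mult_sign n a"
    using mult_sign_odd_modulus_mult[of "p ^ k" n a] cop odd
    by (simp add: n(1) mult_sign_prime_power)
  also have "mult_sign p a = - 1"
    using a(1) g(2) mult_sign_cong[of p a g] odd by (simp add: odd_pos)
  also have "mult_sign n a = 1"
    using a(2) mult_sign_cong[of n a 1] odd by (simp add: odd_pos mult_sign_one)
  finally show ?thesis
    using cop k by (intro exI[of _ a]) (simp add: n(1))
qed

text \<open>
  Negation fixes \<open>b\<close> and reverses \<open>{1..b - 1}\<close>, so it has \<open>(b - 1) * (b - 2) / 2\<close> inversions; for
  \<open>b = 4 * k\<close> this is \<open>(4 * k - 1) * (2 * k - 1)\<close>.
\<close>
lemma mult_sign_minus_one:
  assumes "4 dvd b" "b > 0"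
  shows "mult_sign b (- 1) = - 1"
proof -
  obtain k where k: "b = 4 * k" using assms(1) by auto
  have val: "mult_perm b (- 1) x = (if x = b then b else b - x)" if "x \<in> {1..b}" for x
    unfolding mult_perm_eq_residue_rep[OF that]
    using that by (intro residue_rep_unique) (auto simp: cong_iff_dvd_diff of_nat_diff)
  have "{(i, j). 1 \<le> i \<and> i < j \<and> j \<le> b \<and> mult_perm b (- 1) i > mult_perm b (- 1) j}
      = index_pairs (b - 1)"
    by (auto simp: val index_pairs_def split: if_splits)
  hence inv: "mult_inv (- 1) b = card (index_pairs (b - 1))"
    by (simp add: mult_inv_def inversion_number_def)
  have "4 * k - 1 - 1 = 2 * (2 * k - 1)" by simp
  hence "2 * card (index_pairs (b - 1)) = 2 * ((4 * k - 1) * (2 * k - 1))"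
    unfolding card_index_pairs k by (simp only: mult.left_commute)
  moreover have "odd ((4 * k - 1) * (2 * k - 1))"
    using assms(2) k by (cases k) auto
  ultimately have "odd (mult_inv (- 1) b)" by (simp add: inv)
  thus ?thesis
    using mult_sign_eq_inversion_parity[of b "- 1"] assms(2) by simp
qed

section \<open>Orthogonality and the value of the inversion polynomial\<close>

lemma poly_inversion_poly_minus_one:
  assumes "b > 0"
  shows "poly (inversion_poly b) (- 1) = (\<Sum>a\<in>totatives b. mult_sign b (int a))"
proof -
  have "{a. 1 \<le> a \<and> a \<le> b \<and> coprime a b} = totatives b"
    by (auto simp: totatives_def)
  thus ?thesis
    using assms unfolding inversion_poly_def poly_sum poly_monom
    by (intro sum.cong) (auto simp: totatives_def mult_sign_eq_inversion_parity)
qed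

text \<open>
  Multiplication by \<open>c\<close> permutes the summands and changes the sign of each, so the sum equals its own
  negative.
\<close>
lemma sum_mult_sign_eq_0:
  assumes b: "b > 0" and c: "coprime c (int b)" "mult_sign b c = - 1"
  shows "(\<Sum>a\<in>totatives b. mult_sign b (int a)) = 0"
proof -
  let ?S = "\<Sum>a\<in>totatives b. mult_sign b (int a)" and ?m = "mult_perm b c"
  have cong: "[int (?m a) = c * int a] (mod int b)" and range: "?m a \<in> {1..b}"
    if "a \<in> totatives b" for a
    using mult_perm_spec[of a b c] that by (auto simp: totatives_def)
  have sub: "totatives b \<subseteq> {1..b}" by (auto simp: totatives_def)
  have "coprime (?m a) b" if "a \<in> totatives b" for a
  proof -
    have "coprime (c * int a) (int b)" using that c by (simp add: totatives_def)
    hence "coprime (int (?m a)) (int b)"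
      using cong_imp_coprime cong_sym[OF cong[OF that]] by blast
    thus ?thesis by simp
  qed
  hence "?m ` totatives b \<subseteq> totatives b"
    using range by (auto simp: totatives_def Suc_le_eq)
  moreover have "inj_on ?m (totatives b)"
    using permutes_inj_on[OF mult_perm_permutes[OF c(1)]] .
  ultimately have "bij_betw ?m (totatives b) (totatives b)"
    by (simp add: bij_betw_def endo_inj_surj)
  hence "?S = (\<Sum>a\<in>totatives b. mult_sign b (int (?m a)))"
    by (rule sum.reindex_bij_betw[symmetric])
  also have "\<dots> = (\<Sum>a\<in>totatives b. - mult_sign b (int a))"
  proof (rule sum.cong)
    fix a assume a: "a \<in> totatives b"
    have "mult_sign b (int (?m a)) = mult_sign b (c * int a)"
      using b cong[OF a] by (rule mult_sign_cong)
    also have "\<dots> = - mult_sign b (int a)"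
      using a b c by (simp add: mult_sign_mult totatives_def)
    finally show "mult_sign b (int (?m a)) = - mult_sign b (int a)" .
  qed simp
  finally show ?thesis by (simp add: sum_negf)
qed

theorem proposition2p2:
  fixes b :: nat
  assumes "b > 0"
  shows "((odd b \<and> \<not> is_square b) \<or> 4 dvd b \<longrightarrow> poly (inversion_poly b) (- 1) = 0) \<and>
    ((odd b \<and> is_square b) \<or> [b = 2] (mod 4) \<longrightarrow>
       poly (inversion_poly b) (- 1) = int (totient b)) \<and>
    ([:1, 1:] dvd inversion_poly b \<longleftrightarrow> (odd b \<and> \<not> is_square b) \<or> 4 dvd b) \<and>
    ((odd b \<and> is_square b) \<or> [b = 2] (mod 4) \<longrightarrow>
       (\<forall>a :: int. coprime a (int b) \<longrightarrow> even (mult_inv a b)))"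
proof -
  define vanishing where "vanishing \<longleftrightarrow> (odd b \<and> \<not> is_square b) \<or> 4 dvd b"
  define trivial where "trivial \<longleftrightarrow> (odd b \<and> is_square b) \<or> [b = 2] (mod 4)"
  have zero: "poly (inversion_poly b) (- 1) = 0" if "vanishing"
  proof -
    obtain c where "coprime c (int b)" "mult_sign b c = - 1"
    proof (cases "4 dvd b")
      case True
      thus ?thesis using that[of "- 1"] mult_sign_minus_one[of b] assms by simp
    next
      case False
      thus ?thesis
        using that exists_negative_mult_sign_odd_nonsquare[of b] \<open>vanishing\<close>
        by (auto simp: vanishing_def)
    qed
    thus ?thesis
      using assms by (simp add: poly_inversion_poly_minus_one sum_mult_sign_eq_0)
  qed
  have sign: "mult_sign b a = 1" if "trivial" "coprime a (int b)" for a
    using that mult_sign_odd_square[of b a] mult_sign_twice_odd[of b a]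
    by (auto simp: trivial_def)
  have totient: "poly (inversion_poly b) (- 1) = int (totient b)" if "trivial"
  proof -
    have "(\<Sum>a\<in>totatives b. mult_sign b (int a)) = (\<Sum>a\<in>totatives b. 1)"
      using sign[OF that] by (intro sum.cong) (auto simp: totatives_def)
    thus ?thesis
      using assms by (simp add: poly_inversion_poly_minus_one totient_def)
  qed
  have "even (mult_inv a b)" if "trivial" "coprime a (int b)" for a
  proof (rule ccontr)
    assume "odd (mult_inv a b)"
    thus False
      using mult_sign_eq_inversion_parity[OF assms that(2)] sign[OF that] by simp
  qed
  moreover have "vanishing \<or> trivial"
  proof -
    have "odd b \<or> b mod 4 = 2 \<or> 4 dvd b" by presburger
    thus ?thesis by (auto simp: vanishing_def trivial_def cong_def)
  qed
  moreover have "[:1, 1:] dvd inversion_poly b \<longleftrightarrow> poly (inversion_poly b) (- 1) = 0"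
    by (simp add: poly_eq_0_iff_dvd)
  moreover have "totient b > 0" using assms by simp
  ultimately show ?thesis
    using zero totient unfolding vanishing_def[symmetric] trivial_def[symmetric] by auto
qed

end
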